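(* Let $\{X_n\}_{n=1}^{\infty}$ be a sequence of random variables with common marginal distribution function $F$ and $\{x_n\}_{n=1}^{\infty}$ a sequence of real numbers such that $n\bar F(x_n)\to\tau>0$. Suppose that there is a sequence of positive integers $q_n=o(n)$ such that $\alpha^*_{\lfloor cn\rfloor,q_n}(x_n)\to0$ for all $c>0$. Let $p_n$ be a sequence of positive integers with $p_n=o(n)$, $n\alpha_n=o(p_n)$ and $q_n=o(p_n)$, let $$\theta_{i,n}=\mathbb{P}(M_{i,i+p_n}\le x_n\mid X_i>x_n),$$ suppose that $\theta_i=\lim_{n\to\infty}\theta_{i,n}$ exists for every $i\in\mathbb{N}$, and suppose that $\max_{1\le i\le cn}|\theta_i-\theta_{i,n}|\to0$ for all $c>0$. If $\{\theta_i\}_{i=1}^\infty$ is Cesàro summable, with $\gamma=\lim_{n\to\infty}\frac1n\sum_{i=1}^n\theta_i$, then for each fixed $i\in\mathbb{N}$ and $t>0$, $$\mathbb{P}\big(\bar F(x_n)\,T_i(x_n)>t\big)\to\theta_i\exp(-\gamma t)\qquad\text{as }n\to\infty.$$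
   Context: Notation: $\bar F=1-F$; $M_{j,k}=\max\{X_i:j+1\le i\le k\}$; for a set $A$ of positive integers, $M(A)=\max\{X_i:i\in A\}$ and $|A|$ is its number of elements. An interval is a set of consecutive integers. No stationarity of $\{X_n\}$ is assumed. Limits and $o(\cdot)$ are as $n\to\infty$. Interexceedance time: for $i\in\mathbb{N}$ and a threshold $u$, $T_i(u)=\min\{n\ge1:X_{n+i}>u\mid X_i>u\}$, i.e. $T_i(u)$ is a random variable having the conditional distribution, given $X_i>u$, of $\min\{n\ge1:X_{i+n}>u\}$; thus $\mathbb{P}(T_i(u)>m)=\mathbb{P}(X_{i+1}\le u,\dots,X_{i+m}\le u\mid X_i>u)$ for $m\in\mathbb{N}$. Mixing coefficients: $\mathcal{F}_{j_1,j_2}(u)$ is the $\sigma$-algebra generated by the events $\{X_i>u\}$, $j_1\le i\le j_2$, and $$\alpha^*_{n,q}(u)=\max_{1\le l\le n-q}\ \sup\big|\mathbb{P}(E_2\mid E_1)-\mathbb{P}(E_2)\big|,$$ the supremum being over all $E_1\in\mathcal{F}_{1,l}(u)$ with $\mathbb{P}(E_1)>0$ and all $E_2\in\mathcal{F}_{l+q,n}(u)$. For the given $q_n$, $$\alpha_n=\max\big|\mathbb{P}(M(I_1\cup I_2)\le x_n)-\mathbb{P}(M(I_1)\le x_n)\,\mathbb{P}(M(I_2)\le x_n)\big|,$$ where the maximum is over all pairs of intervals of positive integers $I_1=\{i_1,\dots,i_j\}$, $I_2=\{i_j+q_n+1,\dots,i_j+q_n+k\}$ with $|I_1|\ge q_n$,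 $|I_2|\ge q_n$ and $i_j+q_n+k\le n$. *)

theory Defs
  imports "HOL-Probability.Probability" "HOL-Library.Landau_Symbols"
begin

(* Sequences (X i) are indexed by i >= 1; the value X 0 is never used. *)

definition max_over :: "(nat \<Rightarrow> 'a \<Rightarrow> real) \<Rightarrow> nat set \<Rightarrow> 'a \<Rightarrow> real" where
  "max_over X A \<omega> = Max ((\<lambda>i. X i \<omega>) ` A)"

abbreviation max_between :: "(nat \<Rightarrow> 'a \<Rightarrow> real) \<Rightarrow> nat \<Rightarrow> nat \<Rightarrow> 'a \<Rightarrow> real" where
  "max_between X j k \<equiv> max_over X {j+1..k}"

(* Waiting time after i for the next exceedance of u; it is infinity (Inf of the
   empty set in enat) if there is none. *)
definition next_exceedance :: "(nat \<Rightarrow> 'a \<Rightarrow> real) \<Rightarrow> nat \<Rightarrow> real \<Rightarrow> 'a \<Rightarrow> enat" where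
  "next_exceedance X i u \<omega> = Inf {enat n | n. n \<ge> 1 \<and> X (i + n) \<omega> > u}"

(* The law of T_i(u): the conditional distribution of the waiting time given X_i > u.
   It is a probability measure whenever P(X_i > u) > 0. *)
definition interexceedance_law ::
    "'a measure \<Rightarrow> (nat \<Rightarrow> 'a \<Rightarrow> real) \<Rightarrow> nat \<Rightarrow> real \<Rightarrow> enat measure" where
  "interexceedance_law M X i u =
     distr (uniform_measure M {\<omega> \<in> space M. X i \<omega> > u}) (count_space UNIV)
       (next_exceedance X i u)"

definition exceedance_events ::
    "'a measure \<Rightarrow> (nat \<Rightarrow> 'a \<Rightarrow> real) \<Rightarrow> nat \<Rightarrow> nat \<Rightarrow> real \<Rightarrow> 'a set set" where
  "exceedance_events M X j1 j2 u =
     sigma_sets (space M) {{\<omega> \<in> space M. X i \<omega> > u} | i. j1 \<le> i \<and> i \<le> j2}"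

(* Meaningful for q < n only (otherwise the maximum is over the empty set). *)
definition alpha_star ::
    "'a measure \<Rightarrow> (nat \<Rightarrow> 'a \<Rightarrow> real) \<Rightarrow> nat \<Rightarrow> nat \<Rightarrow> real \<Rightarrow> real" where
  "alpha_star M X n q u =
     (MAX l \<in> {l. 1 \<le> l \<and> l + q \<le> n}.
        Sup {\<bar>\<P>(\<omega> in M. \<omega> \<in> E2 \<bar> \<omega> \<in> E1) - measure M E2\<bar> | E1 E2.
               E1 \<in> exceedance_events M X 1 l u \<and> measure M E1 > 0 \<and>
               E2 \<in> exceedance_events M X (l + q) n u})"

(* The coefficient alpha_n, for q = q_n and u = x_n. The two intervals are
   I1 = {a..b} and I2 = {b+q+1..b+q+k}. Meaningful for 1 <= q and 3 * q <= n only
   (otherwise there may be no admissible pair). *)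
definition alpha_max ::
    "'a measure \<Rightarrow> (nat \<Rightarrow> 'a \<Rightarrow> real) \<Rightarrow> nat \<Rightarrow> nat \<Rightarrow> real \<Rightarrow> real" where
  "alpha_max M X n q u =
     Max {\<bar>\<P>(\<omega> in M. max_over X (I1 \<union> I2) \<omega> \<le> u)
            - \<P>(\<omega> in M. max_over X I1 \<omega> \<le> u) * \<P>(\<omega> in M. max_over X I2 \<omega> \<le> u)\<bar> | I1 I2.
          \<exists>a b k. 1 \<le> a \<and> a \<le> b \<and> I1 = {a..b} \<and> I2 = {b+q+1..b+q+k} \<and>
                  card I1 \<ge> q \<and> card I2 \<ge> q \<and> b + q + k \<le> n}"

definition theta_n ::
    "'a measure \<Rightarrow> (nat \<Rightarrow> 'a \<Rightarrow> real) \<Rightarrow> nat \<Rightarrow> nat \<Rightarrow> real \<Rightarrow> real" where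
  "theta_n M X i p u = \<P>(\<omega> in M. max_between X i (i + p) \<omega> \<le> u \<bar> X i \<omega> > u)"

end

theory Submission
  imports Defs
begin

text \<open>
  Write \<open>b\<close> for the common exceedance probability \<open>P (X\<^sub>k > u)\<close> at the level \<open>u = x\<^sub>n\<close> and,
  for a fixed end point \<open>e\<close>, let \<open>H k\<close> be the probability that no exceedance occurs at the times
  \<open>k + 1, \<dots>, e\<close>. Splitting according to whether time \<open>k + 1\<close> is an exceedance gives
  \<open>H k = H (k + 1) - P (X\<^sub>k\<^sub>+\<^sub>1 > u, no exceedance at k + 2, \<dots>, e)\<close>.

  The subtracted probability factorises approximately. An exceedance at time \<open>j\<close> that is followed
  by none up to time \<open>e\<close> is, in particular, followed by none in the next \<open>p\<close> steps, and this has
  probability \<open>b \<theta>\<^sub>j\<^sub>,\<^sub>n\<close>. By mixing, this local event is nearly independent of what happens at least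
  \<open>q\<close> steps later, and the skipped stretch of length at most \<open>p + q\<close> rarely contains an
  exceedance. So the probability is \<open>b \<theta>\<^sub>j H j\<close> up to an error that is \<open>o(b)\<close> uniformly in
  \<open>j \<le> e - (p + q)\<close>
  (lemma \<open>isolated_exceedance_factorises\<close>).

  Hence \<open>H k = (1 - b \<theta>\<^sub>k\<^sub>+\<^sub>1) H (k + 1) + o(b)\<close>. Iterating backwards from \<open>e\<close> over \<open>O(1/b)\<close> steps,
  of which the first \<open>p + q = o(1/b)\<close> change nothing but an \<open>o(1)\<close> term,
  yields \<open>H i = exp (- b (\<theta>\<^sub>i\<^sub>+\<^sub>1 + \<dots> + \<theta>\<^sub>e)) + o(1)\<close> (lemma \<open>quiet_prob_approx\<close>).
  Finally, \<open>P (b T\<^sub>i > t)\<close> is the conditional probability, given \<open>X\<^sub>i > u\<close>, of no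
  exceedance at the times \<open>i + 1, \<dots>, e\<close> with \<open>e = i + \<lfloor>t / b\<rfloor>\<close>. The
  same factorisation, applied at time \<open>i\<close>, makes it \<open>\<theta>\<^sub>i H i + o(1)\<close>, and Cesaro summability turns
  the exponent into \<open>- \<gamma> t\<close>.

  The recursion resolves single time steps, while the number of steps is of order \<open>1/b\<close>; what makes
  the errors add up to \<open>o(1)\<close> is that \<open>\<alpha>\<^sup>*\<close> bounds conditional probabilities, so that every
  mixing error carries a factor \<open>b\<close>.
\<close>

section \<open>Exceedances of a single level\<close>

locale rare_exceedances = prob_space M for M :: "'a measure" +
  fixes X :: "nat \<Rightarrow> 'a \<Rightarrow> real" and u b :: real
  assumes measurable_X: "i \<ge> 1 \<Longrightarrow> X i \<in> borel_measurable M"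
    and prob_exceeds_eq: "i \<ge> 1 \<Longrightarrow> prob {\<omega> \<in> space M. X i \<omega> > u} = b"
    and b_pos: "b > 0"
begin

definition exceeds :: "nat \<Rightarrow> 'a set" where
  "exceeds i = {\<omega> \<in> space M. X i \<omega> > u}"

definition quiet :: "nat set \<Rightarrow> 'a set" where
  "quiet S = {\<omega> \<in> space M. \<forall>k\<in>S. X k \<omega> \<le> u}"

lemma exceeds_measurable [measurable]: "i \<ge> 1 \<Longrightarrow> exceeds i \<in> events"
  unfolding exceeds_def using measurable_X[of i] by measurable

lemma prob_exceeds: "i \<ge> 1 \<Longrightarrow> prob (exceeds i) = b"
  using prob_exceeds_eq by (simp add: exceeds_def)

lemma quiet_eq: "quiet S = space M - (\<Union>k\<in>S. exceeds k)"
  by (auto simp: quiet_def exceeds_def not_less)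

lemma quiet_subset: "quiet S \<subseteq> space M"
  by (auto simp: quiet_def)

lemma quiet_Un: "quiet (S \<union> T) = quiet S \<inter> quiet T"
  by (auto simp: quiet_def)

lemma quiet_measurable: "(\<And>k. k \<in> S \<Longrightarrow> k \<ge> 1) \<Longrightarrow> quiet S \<in> events"
  unfolding quiet_eq by (intro sets.Diff sets.top sets.countable_UN') auto

lemma prob_not_quiet_le:
  assumes "finite S" and "\<And>k. k \<in> S \<Longrightarrow> k \<ge> 1"
  shows "prob (space M - quiet S) \<le> card S * b"
proof -
  have "space M - quiet S = (\<Union>k\<in>S. exceeds k)"
    by (auto simp: quiet_def exceeds_def not_le)
  also have "prob \<dots> \<le> (\<Sum>k\<in>S. prob (exceeds k))"
    using assms by (intro finite_measure_subadditive_finite) auto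
  also have "\<dots> = card S * b"
    using assms by (simp add: prob_exceeds)
  finally show ?thesis .
qed

lemma prob_quiet_step:
  assumes "k < e"
  shows "prob (quiet {Suc k<..e}) = prob (quiet {k<..e}) + prob (exceeds (Suc k) \<inter> quiet {Suc k<..e})"
proof -
  have "quiet {Suc k<..e} = quiet {k<..e} \<union> (exceeds (Suc k) \<inter> quiet {Suc k<..e})"
  proof -
    have "{k<..e} = insert (Suc k) {Suc k<..e}" using assms by auto
    then show ?thesis by (auto simp: quiet_def exceeds_def)
  qed
  moreover have "quiet {k<..e} \<inter> (exceeds (Suc k) \<inter> quiet {Suc k<..e}) = {}"
  proof -
    have "Suc k \<in> {k<..e}" using assms by simp
    then have "quiet {k<..e} \<inter> exceeds (Suc k) = {}"
      unfolding quiet_eq by blast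
    then show ?thesis by blast
  qed
  moreover have "quiet {k<..e} \<in> events" "exceeds (Suc k) \<inter> quiet {Suc k<..e} \<in> events"
    by (auto intro!: quiet_measurable sets.Int)
  ultimately show ?thesis
    using finite_measure_Union[of "quiet {k<..e}" "exceeds (Suc k) \<inter> quiet {Suc k<..e}"] by metis
qed

lemma theta_n_eq:
  assumes "p > 0" "j \<ge> 1"
  shows "theta_n M X j p u * b = prob (exceeds j \<inter> quiet {j<..j+p})"
proof -
  have "{\<omega> \<in> space M. max_between X j (j + p) \<omega> \<le> u \<and> X j \<omega> > u} = exceeds j \<inter> quiet {j<..j+p}"
    using assms by (auto simp: max_over_def exceeds_def quiet_def)
  then show ?thesis
    using assms b_pos prob_exceeds_eq[of j] by (simp add: theta_n_def cond_prob_def)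
qed

lemma theta_n_bounds:
  assumes "p > 0" "j \<ge> 1"
  shows "0 \<le> theta_n M X j p u" "theta_n M X j p u \<le> 1"
proof -
  have "0 \<le> theta_n M X j p u * b"
    unfolding theta_n_eq[OF assms] by simp
  moreover have "theta_n M X j p u * b \<le> prob (exceeds j)"
    unfolding theta_n_eq[OF assms] using assms by (intro finite_measure_mono) auto
  ultimately show "0 \<le> theta_n M X j p u" "theta_n M X j p u \<le> 1"
    using b_pos assms by (auto simp: prob_exceeds zero_le_mult_iff)
qed


section \<open>Mixing\<close>

lemma exceedance_events_sigma:
  "sigma_algebra (space M) (exceedance_events M X j k u)"
  unfolding exceedance_events_def by (rule sigma_algebra_sigma_sets) auto

lemma exceeds_in_exceedance_events:
  "j \<le> i \<Longrightarrow> i \<le> k \<Longrightarrow> exceeds i \<in> exceedance_events M X j k u"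
  unfolding exceedance_events_def exceeds_def by (rule sigma_sets.Basic) auto

lemma quiet_in_exceedance_events:
  assumes "S \<subseteq> {j..k}"
  shows "quiet S \<in> exceedance_events M X j k u"
proof -
  interpret sigma_algebra "space M" "exceedance_events M X j k u"
    by (rule exceedance_events_sigma)
  show ?thesis
    unfolding quiet_eq using assms
    by (intro Diff top countable_UN') (auto intro!: exceeds_in_exceedance_events)
qed

lemma exceedance_events_subset:
  assumes "j \<ge> 1"
  shows "exceedance_events M X j k u \<subseteq> events"
  unfolding exceedance_events_def
  using assms exceeds_measurable by (intro sets.sigma_sets_subset) (auto simp: exceeds_def)

text \<open>The factor \<open>P(E1)\<close> on the right is what remains of the conditioning in the mixing coefficient;
  it makes the bound relative to the size of the earlier event.\<close>
lemma mixing_bound: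
  assumes l: "1 \<le> l" "l + q \<le> N"
    and E1: "E1 \<in> exceedance_events M X 1 l u"
    and E2: "E2 \<in> exceedance_events M X (l + q) N u"
  shows "\<bar>prob (E1 \<inter> E2) - prob E1 * prob E2\<bar> \<le> prob E1 * alpha_star M X N q u"
proof (cases "prob E1 > 0")
  case True
  define dev where "dev = (\<lambda>l. {\<bar>\<P>(\<omega> in M. \<omega> \<in> E2 \<bar> \<omega> \<in> E1) - prob E2\<bar> | E1 E2.
               E1 \<in> exceedance_events M X 1 l u \<and> prob E1 > 0 \<and>
               E2 \<in> exceedance_events M X (l + q) N u})"
  have ev: "E1 \<in> events" "E2 \<in> events"
    using E1 E2 exceedance_events_subset[of 1 l] exceedance_events_subset[of "l+q" N] l by auto
  have cond01: "0 \<le> \<P>(\<omega> in M. P \<omega> \<bar> Q \<omega>) \<and> \<P>(\<omega> in M. P \<omega> \<bar> Q \<omega>) \<le> 1"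
    if "{\<omega> \<in> space M. Q \<omega>} \<in> events" for P Q
  proof -
    have "prob {\<omega> \<in> space M. P \<omega> \<and> Q \<omega>} \<le> prob {\<omega> \<in> space M. Q \<omega>}"
      using that by (intro finite_measure_mono) auto
    then show ?thesis by (auto simp: cond_prob_def divide_le_eq_1 zero_less_measure_iff)
  qed
  have "bdd_above (dev l)"
  proof (rule bdd_aboveI[of _ 1])
    fix y assume "y \<in> dev l"
    then obtain A B where y: "y = \<bar>\<P>(\<omega> in M. \<omega> \<in> B \<bar> \<omega> \<in> A) - prob B\<bar>"
      and A: "A \<in> exceedance_events M X 1 l u" by (auto simp: dev_def)
    have "A \<in> events" using A exceedance_events_subset[of 1 l] by auto
    then have "{\<omega> \<in> space M. \<omega> \<in> A} \<in> events" by simp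
    from cond01[OF this, of "\<lambda>\<omega>. \<omega> \<in> B"] show "y \<le> 1"
      unfolding y using measure_nonneg[of M B] prob_le_1[of B] by linarith
  qed
  moreover have "\<bar>\<P>(\<omega> in M. \<omega> \<in> E2 \<bar> \<omega> \<in> E1) - prob E2\<bar> \<in> dev l"
    unfolding dev_def using E1 E2 True by blast
  ultimately have "\<bar>\<P>(\<omega> in M. \<omega> \<in> E2 \<bar> \<omega> \<in> E1) - prob E2\<bar> \<le> Sup (dev l)"
    by (rule cSup_upper[rotated])
  also have "\<dots> \<le> alpha_star M X N q u"
  proof -
    have "finite {l. 1 \<le> l \<and> l + q \<le> N}"
      by (rule finite_subset[of _ "{..N}"]) auto
    then show ?thesis
      unfolding alpha_star_def dev_def using l by (intro Max_ge finite_imageI imageI) auto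
  qed
  also have "\<P>(\<omega> in M. \<omega> \<in> E2 \<bar> \<omega> \<in> E1) = prob (E1 \<inter> E2) / prob E1"
  proof -
    have "{\<omega> \<in> space M. \<omega> \<in> E2 \<and> \<omega> \<in> E1} = E1 \<inter> E2" "{\<omega> \<in> space M. \<omega> \<in> E1} = E1"
      using ev sets.sets_into_space by blast+
    then show ?thesis by (simp add: cond_prob_def)
  qed
  finally have "\<bar>prob (E1 \<inter> E2) / prob E1 - prob E2\<bar> \<le> alpha_star M X N q u" .
  moreover have "prob (E1 \<inter> E2) - prob E1 * prob E2 = prob E1 * (prob (E1 \<inter> E2) / prob E1 - prob E2)"
    using True by (simp add: field_simps)
  ultimately show ?thesis
    using True by (simp add: abs_mult)
next
  case False
  then have 0: "prob E1 = 0" by (simp add: zero_less_measure_iff)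
  have "E1 \<in> events" using E1 exceedance_events_subset[of 1 l] by auto
  then have "prob (E1 \<inter> E2) \<le> prob E1" by (intro finite_measure_mono) auto
  with 0 show ?thesis by (simp add: measure_le_0_iff)
qed

text \<open>The times after \<open>j\<close> are cut into a window of length \<open>p\<close>, which decides whether the exceedance
  at \<open>j\<close> is isolated, a gap of length \<open>q - 1\<close>, and the rest. Mixing separates the window from the
  rest across the gap. Inserting the gap costs at most \<open>b (\<alpha>\<^sup>* + q b)\<close>, because
  \<open>q \<le> p\<close> lets mixing separate the exceedance at \<open>j\<close> itself from the gap. Replacing
  quietness of the rest by quietness of all times after \<open>j\<close> changes its probability by at most
  \<open>(p + q) b\<close>.\<close>
lemma isolated_exceedance_factorises:
  assumes q: "1 \<le> q" "q \<le> p" and j: "1 \<le> j" and e: "j + (p + q) \<le> e" "e \<le> N"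
  shows "\<bar>prob (exceeds j \<inter> quiet {j<..e}) - b * theta_n M X j p u * prob (quiet {j<..e})\<bar>
    \<le> b * (2 * alpha_star M X N q u + 2 * (real p + real q) * b)"
proof -
  define \<alpha> where "\<alpha> = alpha_star M X N q u"
  define A where "A = exceeds j"
  define B where "B = quiet {j<..j+p}"
  define C where "C = quiet {j+p<..<j+p+q}"
  define D where "D = quiet {j+p+q..e}"
  have [measurable]: "A \<in> events" "B \<in> events" "C \<in> events" "D \<in> events"
    using j q by (auto simp: A_def B_def C_def D_def intro!: quiet_measurable)
  have D_space: "D \<subseteq> space M" by (simp add: D_def quiet_subset)
  have A: "prob A = b" using j by (simp add: A_def prob_exceeds)
  have H: "quiet {j<..e} = B \<inter> C \<inter> D"
  proof -
    have "{j<..e} = {j<..j+p} \<union> {j+p<..<j+p+q} \<union> {j+p+q..e}" using q e by auto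
    then show ?thesis unfolding B_def C_def D_def by (simp add: quiet_Un)
  qed
  have \<theta>: "theta_n M X j p u * b = prob (A \<inter> B)"
    unfolding A_def B_def using theta_n_eq q j by auto
  have AB: "prob (A \<inter> B) \<le> b"
    unfolding A[symmetric] by (intro finite_measure_mono) auto

  have notC: "prob (space M - C) \<le> q * b"
  proof -
    have "prob (space M - C) \<le> card {j+p<..<j+p+q} * b"
      unfolding C_def using j by (intro prob_not_quiet_le) auto
    also have "\<dots> \<le> q * b"
      using b_pos by (intro mult_right_mono) auto
    finally show ?thesis .
  qed
  have notB: "prob (space M - B) \<le> p * b"
    using prob_not_quiet_le[of "{j<..j+p}"] j unfolding B_def by simp

  have gap: "\<bar>prob (A \<inter> (space M - C)) - prob A * prob (space M - C)\<bar> \<le> prob A * \<alpha>"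
    unfolding \<alpha>_def
  proof (rule mixing_bound[of j])
    interpret S: sigma_algebra "space M" "exceedance_events M X (j+q) N u"
      by (rule exceedance_events_sigma)
    show "space M - C \<in> exceedance_events M X (j+q) N u"
      unfolding C_def using q e
      by (intro S.compl_sets quiet_in_exceedance_events) auto
  qed (use j q e in \<open>auto simp: A_def intro!: exceeds_in_exceedance_events\<close>)
  have "0 \<le> b * \<alpha>" using order_trans[OF abs_ge_zero gap] A by simp
  then have \<alpha>0: "0 \<le> \<alpha>" using b_pos by (simp add: zero_le_mult_iff)

  have "\<bar>prob (A \<inter> B \<inter> D) - prob (A \<inter> B) * prob D\<bar> \<le> prob (A \<inter> B) * \<alpha>"
    unfolding \<alpha>_def
  proof (rule mixing_bound[of "j+p"])
    interpret S: sigma_algebra "space M" "exceedance_events M X 1 (j+p) u"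
      by (rule exceedance_events_sigma)
    show "A \<inter> B \<in> exceedance_events M X 1 (j+p) u"
      unfolding A_def B_def using j
      by (intro S.Int exceeds_in_exceedance_events quiet_in_exceedance_events) auto
  qed (use j q e in \<open>auto simp: D_def intro!: quiet_in_exceedance_events\<close>)
  also have "\<dots> \<le> b * \<alpha>" using AB \<alpha>0 by (rule mult_right_mono)
  finally have 1: "\<bar>prob (A \<inter> B \<inter> D) - prob (A \<inter> B) * prob D\<bar> \<le> b * \<alpha>" .

  have 2: "\<bar>prob (A \<inter> B \<inter> C \<inter> D) - prob (A \<inter> B \<inter> D)\<bar> \<le> b * \<alpha> + b * (q * b)"
  proof -
    have "prob (A \<inter> B \<inter> D) \<le> prob (A \<inter> B \<inter> C \<inter> D) + prob (A \<inter> (space M - C))"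
    proof -
      have "prob (A \<inter> B \<inter> D) \<le> prob ((A \<inter> B \<inter> C \<inter> D) \<union> (A \<inter> (space M - C)))"
        using D_space by (intro finite_measure_mono) auto
      also have "\<dots> \<le> prob (A \<inter> B \<inter> C \<inter> D) + prob (A \<inter> (space M - C))"
        by (intro measure_Un_le) auto
      finally show ?thesis .
    qed
    moreover have "prob (A \<inter> B \<inter> C \<inter> D) \<le> prob (A \<inter> B \<inter> D)"
      by (intro finite_measure_mono) auto
    moreover have "b * prob (space M - C) \<le> b * (q * b)"
      using notC b_pos by simp
    ultimately show ?thesis using gap unfolding A by linarith
  qed

  have 3: "\<bar>prob (A \<inter> B) * prob D - prob (A \<inter> B) * prob (B \<inter> C \<inter> D)\<bar> \<le> b * ((p + q) * b)"
  proof -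
    have "prob D \<le> prob (B \<inter> C \<inter> D) + (prob (space M - B) + prob (space M - C))"
    proof -
      have "prob D \<le> prob ((B \<inter> C \<inter> D) \<union> ((space M - B) \<union> (space M - C)))"
        using D_space by (intro finite_measure_mono) auto
      also have "\<dots> \<le> prob (B \<inter> C \<inter> D) + prob ((space M - B) \<union> (space M - C))"
        by (intro measure_Un_le) auto
      also have "prob ((space M - B) \<union> (space M - C)) \<le> prob (space M - B) + prob (space M - C)"
        by (intro measure_Un_le) auto
      finally show ?thesis by simp
    qed
    moreover have "prob (B \<inter> C \<inter> D) \<le> prob D"
      by (intro finite_measure_mono) auto
    ultimately have "\<bar>prob D - prob (B \<inter> C \<inter> D)\<bar> \<le> (p + q) * b"
      using notB notC by (simp add: algebra_simps)
    then have "prob (A \<inter> B) * \<bar>prob D - prob (B \<inter> C \<inter> D)\<bar> \<le> b * ((p + q) * b)"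
      using AB b_pos by (intro mult_mono) auto
    then show ?thesis by (simp add: abs_mult right_diff_distrib[symmetric])
  qed

  have "\<bar>prob (A \<inter> B \<inter> C \<inter> D) - prob (A \<inter> B) * prob (B \<inter> C \<inter> D)\<bar>
      \<le> b * \<alpha> + (b * \<alpha> + b * (q * b)) + b * ((p + q) * b)"
    using 1 2 3 by linarith
  also have "\<dots> \<le> b * (2 * \<alpha> + 2 * (real p + real q) * b)"
    using b_pos by (simp add: algebra_simps)
  finally show ?thesis
    unfolding H A_def[symmetric] \<alpha>_def[symmetric] using \<theta>
    by (simp add: Int_assoc mult.commute)
qed


section \<open>Exponential decay of the probability of no exceedance\<close>

lemma one_minus_approx_exp:
  fixes y :: real
  assumes "0 \<le> y"
  shows "\<bar>1 - y - exp (- y)\<bar> \<le> y\<^sup>2"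
proof -
  have "1 - y \<le> exp (- y)" using exp_ge_add_one_self[of "- y"] by simp
  moreover have "exp (- y) \<le> 1 - y + y\<^sup>2"
  proof -
    have "1 \<le> 1 + y ^ 3" using assms by simp
    also have "\<dots> = (1 - y + y\<^sup>2) * (1 + y)"
      by (simp add: algebra_simps power2_eq_square power3_eq_cube)
    also have "\<dots> \<le> (1 - y + y\<^sup>2) * exp y"
    proof (rule mult_left_mono)
      have "0 \<le> (1 - y / 2)\<^sup>2 + 3 / 4 * y\<^sup>2" by simp
      also have "\<dots> = 1 - y + y\<^sup>2" by (simp add: power2_eq_square field_simps)
      finally show "0 \<le> 1 - y + y\<^sup>2" .
    qed (use exp_ge_add_one_self[of y] in simp)
    finally show ?thesis by (simp add: exp_minus field_simps)
  qed
  ultimately show ?thesis by linarith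
qed

text \<open>The error of the factorisation, relative to \<open>b\<close>, once \<open>\<theta>\<^sub>j\<^sub>,\<^sub>n\<close> is replaced by a number
  at distance at most \<open>\<delta>\<close> from it.\<close>
definition factorisation_error :: "nat \<Rightarrow> nat \<Rightarrow> nat \<Rightarrow> real \<Rightarrow> real" where
  "factorisation_error N p q \<delta> = \<delta> + 2 * alpha_star M X N q u + 2 * (real p + real q) * b"

text \<open>Backward induction on \<open>i\<close> from \<open>e'\<close>. It starts a distance \<open>p + q\<close> before \<open>e\<close>,
  since closer to \<open>e\<close> there is no room for the window and the gap. Each step replaces
  \<open>1 - b \<theta>\<close> by \<open>exp (- b \<theta>)\<close>, which costs at most \<open>b\<^sup>2\<close>, and multiplies the accumulated error
  by a factor at most \<open>1\<close>.\<close>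
lemma quiet_prob_approx:
  fixes \<theta> :: "nat \<Rightarrow> real"
  assumes q: "1 \<le> q" "q \<le> p" and e: "e = e' + (p + q)" "e \<le> N"
    and \<theta>: "\<And>k. k \<in> {i<..e'} \<Longrightarrow> 0 \<le> \<theta> k \<and> \<theta> k \<le> 1"
    and \<delta>: "\<And>k. k \<in> {i<..e'} \<Longrightarrow> \<bar>\<theta> k - theta_n M X k p u\<bar> \<le> \<delta>"
    and i: "i \<le> e'"
  shows "\<bar>prob (quiet {i<..e}) - exp (- b * (\<Sum>k\<in>{i<..e'}. \<theta> k))\<bar>
    \<le> (real p + real q) * b + real (e' - i) * (b * (factorisation_error N p q \<delta> + b))"
  using i \<theta> \<delta>
proof (induction i rule: inc_induct)
  case base
  have "prob (space M - quiet {e'<..e}) \<le> (real p + real q) * b"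
    using prob_not_quiet_le[of "{e'<..e}"] e by simp
  moreover have "quiet {e'<..e} \<in> events" by (rule quiet_measurable) auto
  ultimately show ?case
    by (simp add: prob_compl)
next
  case (step n)
  define H where "H = (\<lambda>k. prob (quiet {k<..e}))"
  define E where "E = (\<lambda>k. exp (- b * (\<Sum>k\<in>{k<..e'}. \<theta> k)))"
  define y where "y = b * \<theta> (Suc n)"
  define h where "h = factorisation_error N p q \<delta>"
  have \<theta>n: "0 \<le> \<theta> (Suc n)" "\<theta> (Suc n) \<le> 1" and \<delta>n: "\<bar>\<theta> (Suc n) - theta_n M X (Suc n) p u\<bar> \<le> \<delta>"
    using step by auto
  have y: "0 \<le> y" "y \<le> b"
    using \<theta>n b_pos by (auto simp: y_def mult_left_le)
  have H01: "0 \<le> H k" "H k \<le> 1" for k by (auto simp: H_def)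
  have E: "E n = exp (- y) * E (Suc n)"
  proof -
    have "{n<..e'} = insert (Suc n) {Suc n<..e'}" using step by auto
    then have "(\<Sum>k\<in>{n<..e'}. \<theta> k) = \<theta> (Suc n) + (\<Sum>k\<in>{Suc n<..e'}. \<theta> k)" by simp
    then show ?thesis by (simp add: E_def y_def exp_add[symmetric] algebra_simps)
  qed
  have IH: "\<bar>H (Suc n) - E (Suc n)\<bar> \<le> (real p + real q) * b + real (e' - Suc n) * (b * (h + b))"
    unfolding H_def E_def h_def using step by auto

  have "\<bar>prob (exceeds (Suc n) \<inter> quiet {Suc n<..e}) - b * theta_n M X (Suc n) p u * H (Suc n)\<bar>
      \<le> b * (2 * alpha_star M X N q u + 2 * (real p + real q) * b)"
    unfolding H_def using step q e by (intro isolated_exceedance_factorises) auto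
  moreover have "\<bar>y * H (Suc n) - b * theta_n M X (Suc n) p u * H (Suc n)\<bar> \<le> b * \<delta>"
  proof -
    have "y * H (Suc n) - b * theta_n M X (Suc n) p u * H (Suc n)
        = b * ((\<theta> (Suc n) - theta_n M X (Suc n) p u) * H (Suc n))"
      by (simp add: y_def algebra_simps)
    moreover have "\<bar>(\<theta> (Suc n) - theta_n M X (Suc n) p u) * H (Suc n)\<bar> \<le> \<delta> * 1"
      unfolding abs_mult using \<delta>n H01[of "Suc n"] by (intro mult_mono) auto
    ultimately show ?thesis using b_pos by (simp add: abs_mult)
  qed
  moreover have "H (Suc n) = H n + prob (exceeds (Suc n) \<inter> quiet {Suc n<..e})"
    unfolding H_def using step e by (intro prob_quiet_step) auto
  ultimately have "\<bar>H n - (1 - y) * H (Suc n)\<bar> \<le> b * h"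
    by (simp add: h_def factorisation_error_def algebra_simps)
  moreover have "\<bar>(1 - y) * H (Suc n) - exp (- y) * H (Suc n)\<bar> \<le> b * b"
  proof -
    have "\<bar>1 - y - exp (- y)\<bar> * H (Suc n) \<le> y\<^sup>2 * 1"
      using one_minus_approx_exp[OF y(1)] H01[of "Suc n"] by (intro mult_mono) auto
    also have "\<dots> \<le> b * b" using y by (simp add: power2_eq_square mult_mono)
    finally show ?thesis using H01[of "Suc n"] by (simp add: left_diff_distrib[symmetric] abs_mult)
  qed
  moreover have "\<bar>exp (- y) * H (Suc n) - exp (- y) * E (Suc n)\<bar> \<le> \<bar>H (Suc n) - E (Suc n)\<bar>"
    using y by (simp add: right_diff_distrib[symmetric] abs_mult mult_left_le_one_le)
  ultimately have "\<bar>H n - E n\<bar> \<le> b * h + b * b + ((real p + real q) * b + real (e' - Suc n) * (b * (h + b)))"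
    using IH unfolding E by linarith
  also have "\<dots> = (real p + real q) * b + real (e' - n) * (b * (h + b))"
  proof -
    have "real (e' - n) = real (e' - Suc n) + 1" using step by (simp add: of_nat_diff)
    then show ?thesis by (simp add: algebra_simps)
  qed
  finally show ?case unfolding H_def E_def h_def .
qed


section \<open>The law of the interexceedance time\<close>

lemma next_exceedance_gt_iff:
  "enat m < next_exceedance X i u \<omega> \<longleftrightarrow> (\<forall>k\<in>{i<..i+m}. X k \<omega> \<le> u)"
proof -
  have "enat m < next_exceedance X i u \<omega> \<longleftrightarrow> enat (Suc m) \<le> next_exceedance X i u \<omega>"
    by (simp add: Suc_ile_eq)
  also have "\<dots> \<longleftrightarrow> (\<forall>n. n \<ge> 1 \<and> X (i + n) \<omega> > u \<longrightarrow> Suc m \<le> n)"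
    unfolding next_exceedance_def le_Inf_iff by auto
  also have "\<dots> \<longleftrightarrow> (\<forall>k\<in>{i<..i+m}. X k \<omega> \<le> u)"
  proof safe
    fix k assume *: "\<forall>n. n \<ge> 1 \<and> X (i + n) \<omega> > u \<longrightarrow> Suc m \<le> n" and k: "k \<in> {i<..i+m}"
    show "X k \<omega> \<le> u" using *[rule_format, of "k - i"] k by force
  next
    fix n assume *: "\<forall>k\<in>{i<..i+m}. X k \<omega> \<le> u" and n: "n \<ge> 1" "X (i + n) \<omega> > u"
    show "Suc m \<le> n" using *[rule_format, of "i + n"] n by force
  qed
  finally show ?thesis .
qed

lemma next_exceedance_measurable:
  assumes "i \<ge> 1"
  shows "next_exceedance X i u \<in> measurable M (count_space UNIV)"
proof -
  have "next_exceedance X i u = (\<lambda>\<omega>. INF n\<in>{1..}. if X (i + n) \<omega> > u then enat n else \<infinity>)"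
  proof
    fix \<omega>
    show "next_exceedance X i u \<omega> = (INF n\<in>{1..}. if X (i + n) \<omega> > u then enat n else \<infinity>)"
    proof (rule antisym)
      show "next_exceedance X i u \<omega> \<le> (INF n\<in>{1..}. if X (i + n) \<omega> > u then enat n else \<infinity>)"
        unfolding next_exceedance_def by (rule INF_greatest) (auto intro!: Inf_lower)
      show "(INF n\<in>{1..}. if X (i + n) \<omega> > u then enat n else \<infinity>) \<le> next_exceedance X i u \<omega>"
        unfolding next_exceedance_def
      proof (rule Inf_greatest)
        fix s assume "s \<in> {enat n | n. n \<ge> 1 \<and> X (i + n) \<omega> > u}"
        then obtain n where "s = enat n" "n \<ge> 1" "X (i + n) \<omega> > u" by auto
        then show "(INF n\<in>{1..}. if X (i + n) \<omega> > u then enat n else \<infinity>) \<le> s"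
          by (intro INF_lower2[of n]) auto
      qed
    qed
  qed
  also have "\<dots> \<in> measurable M (count_space UNIV)"
  proof (rule measurable_INF)
    fix n :: nat assume "n \<in> {1..}"
    then have [measurable]: "X (i + n) \<in> borel_measurable M" by (intro measurable_X) auto
    show "(\<lambda>\<omega>. if X (i + n) \<omega> > u then enat n else \<infinity>) \<in> measurable M (count_space UNIV)"
      by measurable
  qed simp
  finally show ?thesis .
qed

lemma interexceedance_law_gt:
  assumes i: "i \<ge> 1"
  shows "measure (interexceedance_law M X i u) {s. enat m < s}
    = prob (exceeds i \<inter> quiet {i<..i+m}) / b"
proof -
  have "measure (interexceedance_law M X i u) {s. enat m < s}
      = measure (uniform_measure M (exceeds i)) (next_exceedance X i u -` {s. enat m < s} \<inter> space M)"
    unfolding interexceedance_law_def exceeds_def[symmetric]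
    by (subst measure_distr) (use next_exceedance_measurable[OF i] in auto)
  also have "next_exceedance X i u -` {s. enat m < s} \<inter> space M = quiet {i<..i+m}"
    by (auto simp: next_exceedance_gt_iff quiet_def)
  also have "measure (uniform_measure M (exceeds i)) \<dots> = prob (exceeds i \<inter> quiet {i<..i+m}) / b"
    using i b_pos prob_exceeds[OF i]
    by (subst measure_uniform_measure) (auto simp: emeasure_eq_measure intro!: quiet_measurable)
  finally show ?thesis .
qed

text \<open>A scaled integer exceeds \<open>t\<close> exactly when the integer exceeds \<open>\<lfloor>t / b\<rfloor>\<close>, and the value
  infinity satisfies both conditions.\<close>
lemma scaled_gt_eq:
  assumes "t > 0"
  shows "{s. ereal b * ereal_of_enat s > ereal t} = {s. enat (nat \<lfloor>t / b\<rfloor>) < s}"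
proof (rule Collect_cong)
  fix s :: enat
  show "ereal b * ereal_of_enat s > ereal t \<longleftrightarrow> enat (nat \<lfloor>t / b\<rfloor>) < s"
  proof (cases s)
    case (enat k)
    have "ereal b * ereal_of_enat s > ereal t \<longleftrightarrow> t / b < real k"
      using b_pos enat by (simp add: field_simps)
    also have "\<dots> \<longleftrightarrow> \<lfloor>t / b\<rfloor> < int k" by (simp add: floor_less_iff)
    also have "\<dots> \<longleftrightarrow> nat \<lfloor>t / b\<rfloor> < k" using assms b_pos by (auto simp: nat_less_iff)
    finally show ?thesis using enat by simp
  qed (use b_pos in simp)
qed

lemma interexceedance_law_approx:
  fixes \<theta> :: "nat \<Rightarrow> real"
  assumes q: "1 \<le> q" "q \<le> p" and i: "i \<ge> 1" and d: "p + q \<le> m" and N: "i + m \<le> N"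
    and \<theta>: "\<And>k. k \<ge> 1 \<Longrightarrow> 0 \<le> \<theta> k \<and> \<theta> k \<le> 1"
    and \<delta>: "\<And>k. k \<in> {i..i+m} \<Longrightarrow> \<bar>\<theta> k - theta_n M X k p u\<bar> \<le> \<delta>"
  shows "\<bar>measure (interexceedance_law M X i u) {s. enat m < s}
      - \<theta> i * exp (- b * (\<Sum>k\<in>{i<..i+m-(p+q)}. \<theta> k))\<bar>
    \<le> factorisation_error N p q \<delta> + (real p + real q) * b + real m * b * (factorisation_error N p q \<delta> + b)"
proof -
  define h where "h = factorisation_error N p q \<delta>"
  define H where "H = prob (quiet {i<..i+m})"
  define E where "E = exp (- b * (\<Sum>k\<in>{i<..i+m-(p+q)}. \<theta> k))"
  define J where "J = prob (exceeds i \<inter> quiet {i<..i+m})"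
  have H01: "0 \<le> H" "H \<le> 1" by (auto simp: H_def)
  have "\<bar>J - b * theta_n M X i p u * H\<bar> \<le> b * (2 * alpha_star M X N q u + 2 * (real p + real q) * b)"
    unfolding H_def J_def using assms by (intro isolated_exceedance_factorises) auto
  moreover have "J - b * theta_n M X i p u * H = b * (J / b - theta_n M X i p u * H)"
    using b_pos by (simp add: field_simps)
  ultimately have "\<bar>J / b - theta_n M X i p u * H\<bar> \<le> 2 * alpha_star M X N q u + 2 * (real p + real q) * b"
    using b_pos by (simp add: abs_mult)
  moreover have "\<bar>theta_n M X i p u * H - \<theta> i * H\<bar> \<le> \<delta>"
  proof -
    have "\<bar>theta_n M X i p u - \<theta> i\<bar> * H \<le> \<delta> * 1"
      using \<delta>[of i] H01 by (intro mult_mono) auto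
    then show ?thesis using H01 by (simp add: left_diff_distrib[symmetric] abs_mult)
  qed
  ultimately have 1: "\<bar>J / b - \<theta> i * H\<bar> \<le> h"
    unfolding h_def factorisation_error_def by linarith

  have HE: "\<bar>H - E\<bar> \<le> (real p + real q) * b + real (i + m - (p + q) - i) * (b * (h + b))"
    unfolding H_def E_def h_def
    using q d N \<theta> \<delta> by (intro quiet_prob_approx) auto
  also have "\<dots> \<le> (real p + real q) * b + real m * (b * (h + b))"
  proof -
    have "0 \<le> h" using 1 by linarith
    then show ?thesis using b_pos by (intro add_mono mult_right_mono) auto
  qed
  finally have "\<bar>\<theta> i * H - \<theta> i * E\<bar> \<le> (real p + real q) * b + real m * (b * (h + b))"
    using \<theta>[OF i] by (simp add: right_diff_distrib[symmetric] abs_mult)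
      (meson abs_ge_zero mult_left_le_one_le order_trans)
  with 1 have "\<bar>J / b - \<theta> i * E\<bar> \<le> h + (real p + real q) * b + real m * b * (h + b)"
    by (simp add: algebra_simps)
  then show ?thesis
    unfolding interexceedance_law_gt[OF i] J_def E_def h_def .
qed

end


section \<open>Passage to the limit\<close>

theorem theorem2p6:
  fixes M :: "'a measure" and X :: "nat \<Rightarrow> 'a \<Rightarrow> real" and F :: "real \<Rightarrow> real"
    and x :: "nat \<Rightarrow> real" and \<tau> \<gamma> :: real and p q :: "nat \<Rightarrow> nat" and \<theta> :: "nat \<Rightarrow> real"
  assumes "prob_space M"
    and "\<And>i. i \<ge> 1 \<Longrightarrow> X i \<in> borel_measurable M"
    and "\<And>i. i \<ge> 1 \<Longrightarrow> cdf (distr M borel (X i)) = F"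
    and "\<tau> > 0"
    and "(\<lambda>n. real n * (1 - F (x n))) \<longlonglongrightarrow> \<tau>"
    and "\<And>n. n \<ge> 1 \<Longrightarrow> q n > 0"
    and "(\<lambda>n. real (q n)) \<in> o(\<lambda>n. real n)"
    and "\<And>c::real. c > 0 \<Longrightarrow>
           (\<lambda>n. alpha_star M X (nat \<lfloor>c * real n\<rfloor>) (q n) (x n)) \<longlonglongrightarrow> 0"
    and "\<And>n. n \<ge> 1 \<Longrightarrow> p n > 0"
    and "(\<lambda>n. real (p n)) \<in> o(\<lambda>n. real n)"
    and "(\<lambda>n. real n * alpha_max M X n (q n) (x n)) \<in> o(\<lambda>n. real (p n))"
    and "(\<lambda>n. real (q n)) \<in> o(\<lambda>n. real (p n))"
    and "\<And>i. i \<ge> 1 \<Longrightarrow> (\<lambda>n. theta_n M X i (p n) (x n)) \<longlonglongrightarrow> \<theta> i"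
    and "\<And>c::real. c > 0 \<Longrightarrow>
           (\<lambda>n. MAX i \<in> {i. 1 \<le> i \<and> real i \<le> c * real n}.
                  \<bar>\<theta> i - theta_n M X i (p n) (x n)\<bar>) \<longlonglongrightarrow> 0"
    and "(\<lambda>n. (\<Sum>i=1..n. \<theta> i) / real n) \<longlonglongrightarrow> \<gamma>"
  shows "\<forall>i\<ge>1. \<forall>t>0.
           (\<lambda>n. measure (interexceedance_law M X i (x n))
                  {s. ereal (1 - F (x n)) * ereal_of_enat s > ereal t})
           \<longlonglongrightarrow> \<theta> i * exp (- \<gamma> * t)"
proof (intro allI impI)
  fix i :: nat and t :: real assume i: "i \<ge> 1" and t: "t > 0"
  interpret prob_space M by fact
  define b where "b = (\<lambda>n. 1 - F (x n))"
  define m where "m = (\<lambda>n. nat \<lfloor>t / b n\<rfloor>)"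
  define d where "d = (\<lambda>n. p n + q n)"
  \<comment> \<open>The horizon \<open>i + m n\<close> is asymptotically \<open>n t / \<tau>\<close>, so any \<open>c > t / \<tau>\<close> makes the uniform
    hypotheses on \<open>{1..c n}\<close> cover it.\<close>
  define c where "c = t / \<tau> + 1"
  define N where "N = (\<lambda>n. nat \<lfloor>c * real n\<rfloor>)"
  define \<delta> where "\<delta> = (\<lambda>n. MAX i \<in> {i. 1 \<le> i \<and> real i \<le> c * real n}. \<bar>\<theta> i - theta_n M X i (p n) (x n)\<bar>)"
  define \<eta> where "\<eta> = (\<lambda>n. \<delta> n + 2 * alpha_star M X (N n) (q n) (x n) + 2 * (real (p n) + real (q n)) * b n)"
  define S where "S = (\<lambda>n. \<Sum>k=1..n. \<theta> k)"

  have nb: "(\<lambda>n. real n * b n) \<longlonglongrightarrow> \<tau>" using assms(5) by (simp add: b_def)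
  have c: "c > 0" using t assms(4) by (simp add: c_def add_pos_pos)

  have ev_b: "\<forall>\<^sub>F n in sequentially. 0 < b n \<and> n > 0"
    using order_tendstoD(1)[OF nb assms(4)] eventually_gt_at_top[of 0]
    by eventually_elim (auto simp: zero_less_mult_iff)
  have ev_q: "\<forall>\<^sub>F n in sequentially. q n \<le> p n"
    using landau_o.smallD[OF assms(12), of 1] by simp
  have inverse0: "(\<lambda>n. 1 / real n) \<longlonglongrightarrow> 0" by (rule lim_1_over_n)
  have b0: "b \<longlonglongrightarrow> 0"
  proof (rule Lim_transform_eventually)
    show "(\<lambda>n. real n * b n * (1 / real n)) \<longlonglongrightarrow> 0" using tendsto_mult[OF nb inverse0] by simp
    show "\<forall>\<^sub>F n in sequentially. real n * b n * (1 / real n) = b n"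
      using eventually_gt_at_top[of 0] by eventually_elim simp
  qed

  have exceedances: "rare_exceedances M X (x n) (b n)" if "b n > 0" for n
  proof
    fix k :: nat assume k: "k \<ge> 1"
    show X: "X k \<in> borel_measurable M" using assms(2) k .
    have "F (x n) = cdf (distr M borel (X k)) (x n)" using assms(3)[OF k] by simp
    also have "\<dots> = prob {\<omega> \<in> space M. X k \<omega> \<le> x n}"
      unfolding cdf_def using X by (subst measure_distr) (auto intro!: arg_cong[where f=prob])
    also have "\<dots> = 1 - prob {\<omega> \<in> space M. X k \<omega> > x n}"
    proof -
      have "{\<omega> \<in> space M. X k \<omega> \<le> x n} = space M - {\<omega> \<in> space M. X k \<omega> > x n}" by auto
      moreover have "{\<omega> \<in> space M. X k \<omega> > x n} \<in> events" using X by measurable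
      ultimately show ?thesis using prob_compl by metis
    qed
    finally show "prob {\<omega> \<in> space M. X k \<omega> > x n} = b n" by (simp add: b_def)
  qed fact

  have \<theta>: "0 \<le> \<theta> k \<and> \<theta> k \<le> 1" if k: "k \<ge> 1" for k
  proof -
    have "\<forall>\<^sub>F n in sequentially. 0 \<le> theta_n M X k (p n) (x n) \<and> theta_n M X k (p n) (x n) \<le> 1"
      using ev_b
    proof eventually_elim
      case (elim n)
      then interpret rare_exceedances M X "x n" "b n" by (intro exceedances) simp
      show ?case using theta_n_bounds[of "p n" k] elim assms(9) k by simp
    qed
    then show ?thesis
      using tendsto_lowerbound[OF assms(13)[OF k]] tendsto_upperbound[OF assms(13)[OF k]]
      by (auto simp: eventually_conj_iff)
  qed

  have mb: "(\<lambda>n. real (m n) * b n) \<longlonglongrightarrow> t"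
  proof (rule tendsto_sandwich)
    show "(\<lambda>n. t - b n) \<longlonglongrightarrow> t" using tendsto_diff[OF tendsto_const b0] by simp
    show "\<forall>\<^sub>F n in sequentially. t - b n \<le> real (m n) * b n"
      using ev_b
    proof eventually_elim
      case (elim n)
      have "t / b n - 1 \<le> real (m n)" unfolding m_def by linarith
      then show ?case using elim by (simp add: field_simps)
    qed
    show "\<forall>\<^sub>F n in sequentially. real (m n) * b n \<le> t"
      using ev_b
    proof eventually_elim
      case (elim n)
      have "real (m n) \<le> t / b n" unfolding m_def using elim t by simp
      then show ?case using elim by (simp add: field_simps)
    qed
  qed simp
  have mn: "(\<lambda>n. real (m n) / real n) \<longlonglongrightarrow> t / \<tau>"
  proof (rule Lim_transform_eventually)
    show "(\<lambda>n. (real (m n) * b n) / (real n * b n)) \<longlonglongrightarrow> t / \<tau>"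
      using assms(4) by (intro tendsto_divide mb nb) simp
    show "\<forall>\<^sub>F n in sequentially. (real (m n) * b n) / (real n * b n) = real (m n) / real n"
      using ev_b by eventually_elim simp
  qed
  have dn: "(\<lambda>n. real (d n) / real n) \<longlonglongrightarrow> 0"
    using tendsto_add[OF smalloD_tendsto[OF assms(10)] smalloD_tendsto[OF assms(7)]]
    by (simp add: d_def add_divide_distrib)
  have db: "(\<lambda>n. real (d n) * b n) \<longlonglongrightarrow> 0"
  proof (rule Lim_transform_eventually)
    show "(\<lambda>n. real (d n) / real n * (real n * b n)) \<longlonglongrightarrow> 0" using tendsto_mult[OF dn nb] by simp
    show "\<forall>\<^sub>F n in sequentially. real (d n) / real n * (real n * b n) = real (d n) * b n"
      using ev_b by eventually_elim simp
  qed

  have ev_d: "\<forall>\<^sub>F n in sequentially. d n \<le> m n"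
  proof -
    have "(\<lambda>n. real (m n) / real n - real (d n) / real n) \<longlonglongrightarrow> t / \<tau>"
      using tendsto_diff[OF mn dn] by simp
    then have "\<forall>\<^sub>F n in sequentially. 0 < real (m n) / real n - real (d n) / real n"
      by (rule order_tendstoD) (use t assms(4) in simp)
    then show ?thesis using ev_b
      by eventually_elim (simp add: field_simps)
  qed
  have ev_N: "\<forall>\<^sub>F n in sequentially. real (i + m n) \<le> c * real n"
  proof -
    have "(\<lambda>n. real i * (1 / real n) + real (m n) / real n) \<longlonglongrightarrow> real i * 0 + t / \<tau>"
      by (intro tendsto_intros inverse0 mn)
    then have "\<forall>\<^sub>F n in sequentially. real i * (1 / real n) + real (m n) / real n < c"
      by (rule order_tendstoD) (simp add: c_def)
    then show ?thesis using ev_b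
      by eventually_elim (simp add: field_simps)
  qed

  have \<eta>0: "\<eta> \<longlonglongrightarrow> 0"
  proof -
    have "(\<lambda>n. \<delta> n + 2 * alpha_star M X (N n) (q n) (x n) + 2 * (real (d n) * b n)) \<longlonglongrightarrow> 0 + 2 * 0 + 2 * 0"
      unfolding \<delta>_def N_def by (intro tendsto_intros assms(14) assms(8) c db)
    then show ?thesis by (simp add: \<eta>_def d_def algebra_simps)
  qed

  define L where "L = (\<lambda>n. measure (interexceedance_law M X i (x n)) {s. ereal (1 - F (x n)) * ereal_of_enat s > ereal t})"
  define E where "E = (\<lambda>n. \<theta> i * exp (- b n * (\<Sum>k\<in>{i<..i + m n - d n}. \<theta> k)))"
  have "(\<lambda>n. L n - E n) \<longlonglongrightarrow> 0"
  proof (rule Lim_null_comparison)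
    show "\<forall>\<^sub>F n in sequentially. norm (L n - E n) \<le> \<eta> n + real (d n) * b n + real (m n) * b n * (\<eta> n + b n)"
      using ev_b ev_q ev_d ev_N
    proof eventually_elim
      case (elim n)
      then interpret rare_exceedances M X "x n" "b n" by (intro exceedances) simp
      have "finite {k. 1 \<le> k \<and> real k \<le> c * real n}"
      proof (rule finite_subset)
        show "{k. 1 \<le> k \<and> real k \<le> c * real n} \<subseteq> {..nat \<lfloor>c * real n\<rfloor>}" by (auto simp: le_nat_floor)
      qed simp
      then have "\<bar>\<theta> k - theta_n M X k (p n) (x n)\<bar> \<le> \<delta> n" if "k \<in> {i..i + m n}" for k
        unfolding \<delta>_def using that i elim by (intro Max_ge finite_imageI imageI) auto
      moreover have "L n = measure (interexceedance_law M X i (x n)) {s. enat (m n) < s}"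
        unfolding L_def m_def using scaled_gt_eq[OF t] by (simp add: b_def)
      moreover have "1 \<le> q n" using assms(6)[of n] elim by simp
      moreover have "i + m n \<le> N n" using elim by (simp add: N_def le_nat_floor)
      ultimately show ?case
        using interexceedance_law_approx[of "q n" "p n" i "m n" "N n" \<theta> "\<delta> n"] \<theta> elim i
        unfolding factorisation_error_def by (simp add: E_def \<eta>_def d_def)
    qed
    have "(\<lambda>n. \<eta> n + real (d n) * b n + real (m n) * b n * (\<eta> n + b n)) \<longlonglongrightarrow> 0 + 0 + t * (0 + 0)"
      by (intro tendsto_intros \<eta>0 db mb b0)
    then show "(\<lambda>n. \<eta> n + real (d n) * b n + real (m n) * b n * (\<eta> n + b n)) \<longlonglongrightarrow> 0" by simp
  qed
  moreover have "E \<longlonglongrightarrow> \<theta> i * exp (- \<gamma> * t)"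
  proof -
    define e where "e = (\<lambda>n. i + m n - d n)"
    have eb: "(\<lambda>n. real (e n) * b n) \<longlonglongrightarrow> t"
    proof (rule Lim_transform_eventually)
      have "(\<lambda>n. real i * b n + real (m n) * b n - real (d n) * b n) \<longlonglongrightarrow> real i * 0 + t - 0"
        by (intro tendsto_intros b0 mb db)
      then show "(\<lambda>n. real i * b n + real (m n) * b n - real (d n) * b n) \<longlonglongrightarrow> t" by simp
      show "\<forall>\<^sub>F n in sequentially. real i * b n + real (m n) * b n - real (d n) * b n = real (e n) * b n"
        using ev_d by eventually_elim (simp add: e_def of_nat_diff algebra_simps)
    qed
    have "filterlim e at_top sequentially"
    proof -
      have "filterlim b (at_right 0) sequentially"
        using b0 ev_b by (auto simp: filterlim_at elim: eventually_mono)
      then have "filterlim (\<lambda>n. inverse (b n)) at_top sequentially"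
        using filterlim_inverse_at_top_right by (rule filterlim_compose[rotated])
      then have "filterlim (\<lambda>n. real (e n) * b n * inverse (b n)) at_top sequentially"
        by (rule filterlim_tendsto_pos_mult_at_top[OF eb t])
      moreover have "\<forall>\<^sub>F n in sequentially. real (e n) * b n * inverse (b n) = real (e n)"
        using ev_b by eventually_elim simp
      ultimately show ?thesis
        unfolding filterlim_sequentially_iff_filterlim_real
        by (subst filterlim_cong[OF refl refl, symmetric]) (auto elim: eventually_mono)
    qed
    then have Se: "(\<lambda>n. S (e n) / real (e n)) \<longlonglongrightarrow> \<gamma>" and e_pos: "\<forall>\<^sub>F n in sequentially. e n > 0"
      using filterlim_compose[OF assms(15)] eventually_compose_filterlim[OF eventually_gt_at_top[of 0]]
      unfolding S_def by auto
    \<comment> \<open>The sum is the Cesaro mean at \<open>e n\<close> times \<open>e n\<close>, less a fixed number of terms that \<open>b n\<close>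
      makes negligible.\<close>
    have "(\<lambda>n. b n * (\<Sum>k\<in>{i<..e n}. \<theta> k)) \<longlonglongrightarrow> \<gamma> * t"
    proof (rule Lim_transform_eventually)
      have "(\<lambda>n. S (e n) / real (e n) * (real (e n) * b n) - b n * S i) \<longlonglongrightarrow> \<gamma> * t - 0 * S i"
        by (intro tendsto_intros Se eb b0)
      then show "(\<lambda>n. S (e n) / real (e n) * (real (e n) * b n) - b n * S i) \<longlonglongrightarrow> \<gamma> * t" by simp
      show "\<forall>\<^sub>F n in sequentially. S (e n) / real (e n) * (real (e n) * b n) - b n * S i
          = b n * (\<Sum>k\<in>{i<..e n}. \<theta> k)"
        using ev_d e_pos
      proof eventually_elim
        case (elim n)
        have "{1..e n} = {1..i} \<union> {i<..e n}" using elim i by (auto simp: e_def)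
        then have "S (e n) = S i + (\<Sum>k\<in>{i<..e n}. \<theta> k)"
          unfolding S_def by (simp add: sum.union_disjoint disjoint_iff)
        then show ?case using elim by (simp add: field_simps)
      qed
    qed
    then have "(\<lambda>n. \<theta> i * exp (- (b n * (\<Sum>k\<in>{i<..e n}. \<theta> k)))) \<longlonglongrightarrow> \<theta> i * exp (- (\<gamma> * t))"
      by (rule tendsto_mult[OF tendsto_const tendsto_exp[OF tendsto_minus]])
    then show ?thesis by (simp add: E_def e_def)
  qed
  ultimately show "L \<longlonglongrightarrow> \<theta> i * exp (- \<gamma> * t)"
    using tendsto_add[of "\<lambda>n. L n - E n" 0 sequentially E] by simp
qed

end
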